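(* Let $p$ be a prime number. Then there exists an integer $m\ge1$, depending only on $p$ and $\mathscr{B}$, such that for any integer $s\ge1$ and each cylinder set $C\subset X$, $$\frac1{p^m}\sum_{r=0}^{p^m-1}\ \frac1N\sum_{0\le n<N}\mathbf{1}_C\bigl(S^{np^s+r}\eta\bigr)\longrightarrow\nu_{\mathscr{B}}(C)\qquad\text{as }N\to\infty.$$
   Context: $\mathbb{N}^*=\{1,2,3,\ldots\}$. $\mathscr{B}=\{b_k:k\ge1\}\subset\{2,3,4,\ldots\}$ is a given infinite set of pairwise relatively prime integers with $\sum_{k\ge1}1/b_k<\infty$. $X=\{0,1\}^{\mathbb{N}^*}$, and $S:X\to X$ is the shift, $(Sx)_n=x_{n+1}$. A cylinder set is a subset of $X$ obtained by prescribing the values of finitely many coordinates. The sequence $\eta=(\eta_n)_{n\in\mathbb{N}^*}\in X$ is defined by $\eta_n=0$ if some $b_k$ divides $n$, and $\eta_n=1$ otherwise. $\Omega=\prod_{k\ge1}\mathbb{Z}/b_k\mathbb{Z}$ with normalized Haar measure $\mathbb{P}$. The map $\varphi:\Omega\to X$ is defined by: $\varphi(\omega)_n=0$ if there exists $k\ge1$ with $\omega_k+n\equiv0\bmod b_k$, and $\varphi(\omega)_n=1$ otherwise ($n\in\mathbb{N}^*$). $\nu_{\mathscr{B}}$ is the pushforward of $\mathbb{P}$ by $\varphi$: $\nu_{\mathscr{B}}(C)=\mathbb{P}(\varphi^{-1}C)$. *)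

theory Defs
  imports "HOL-Probability.Probability" "HOL-Computational_Algebra.Primes"
begin

text \<open>
  Sequences indexed by \<open>{1, 2, 3, \<dots>}\<close> are extensional functions on \<open>{1..}\<close>
  (\<^const>\<open>undefined\<close> at \<open>0\<close>), so equality in \<open>seq_space\<close> is equality of the
  coordinates \<open>1, 2, 3, \<dots>\<close>.
\<close>

definition seq_space :: "(nat \<Rightarrow> nat) set" where
  "seq_space = {1..} \<rightarrow>\<^sub>E {0, 1}"

definition seq_shift :: "(nat \<Rightarrow> nat) \<Rightarrow> nat \<Rightarrow> nat" where
  "seq_shift x = (\<lambda>n\<in>{1..}. x (n + 1))"

definition is_cylinder :: "(nat \<Rightarrow> nat) set \<Rightarrow> bool" where
  "is_cylinder C \<longleftrightarrow>
     (\<exists>F a. finite F \<and> F \<subseteq> {1..} \<and> a \<in> F \<rightarrow> {0, 1} \<and> C = {x \<in> seq_space. \<forall>i\<in>F. x i = a i})"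

definition eta :: "nat set \<Rightarrow> nat \<Rightarrow> nat" where
  "eta B = (\<lambda>n\<in>{1..}. if \<exists>b\<in>B. b dvd n then 0 else 1)"

text \<open>
  The product of the groups \<open>\<int>/b\<int>\<close> is indexed by the elements \<open>b\<close> of \<open>B\<close> themselves, and a
  residue class is represented by its representative in \<open>{..<b}\<close>. Normalized Haar measure on
  the product is the product of the uniform measures; translation invariance is
  \<open>Omega_translation_invariant\<close> below.
\<close>

definition Omega :: "nat set \<Rightarrow> (nat \<Rightarrow> nat) measure" where
  "Omega B = (\<Pi>\<^sub>M b\<in>B. uniform_count_measure {..<b})"

definition phi :: "nat set \<Rightarrow> (nat \<Rightarrow> nat) \<Rightarrow> nat \<Rightarrow> nat" where
  "phi B \<omega> = (\<lambda>n\<in>{1..}. if \<exists>b\<in>B. (\<omega> b + n) mod b = 0 then 0 else 1)"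

definition nu :: "nat set \<Rightarrow> (nat \<Rightarrow> nat) measure" where
  "nu B = distr (Omega B) (\<Pi>\<^sub>M n\<in>{1..}. count_space {0, 1}) (phi B)"

lemma eta_in_seq_space: "eta B \<in> seq_space"
  by (auto simp: eta_def seq_space_def)

lemma seq_shift_in_seq_space: "x \<in> seq_space \<Longrightarrow> seq_shift x \<in> seq_space"
  by (simp add: seq_shift_def seq_space_def PiE_iff)

lemma space_Omega: "space (Omega B) = (\<Pi>\<^sub>E b\<in>B. {..<b})"
  by (simp add: Omega_def space_PiM space_uniform_count_measure)

lemma prob_space_Omega:
  assumes "\<And>b. b \<in> B \<Longrightarrow> b \<ge> 2"
  shows "prob_space (Omega B)"
  unfolding Omega_def
proof (rule prob_space_PiM)
  fix b assume "b \<in> B"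
  with assms[of b] show "prob_space (uniform_count_measure {..<b})"
    by (intro prob_space_uniform_count_measure) (auto simp: lessThan_empty_iff)
qed

lemma measurable_phi [measurable]:
  "phi B \<in> measurable (Omega B) (\<Pi>\<^sub>M n\<in>{1..}. count_space {0, 1})"
  unfolding phi_def
proof (rule measurable_restrict)
  fix n :: nat
  have "{\<omega> \<in> space (Omega B). \<exists>b\<in>B. (\<omega> b + n) mod b = 0} \<in> sets (Omega B)"
  proof (rule sets.sets_Collect_countable_Ex')
    fix b assume b: "b \<in> B"
    have "(\<lambda>\<omega>. \<omega> b) \<in> measurable (Omega B) (uniform_count_measure {..<b})"
      unfolding Omega_def using b by (rule measurable_component_singleton)
    then have "(\<lambda>\<omega>. \<omega> b) -` {c\<in>{..<b}. (c + n) mod b = 0} \<inter> space (Omega B) \<in> sets (Omega B)"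
      by (rule measurable_sets) (auto simp: sets_uniform_count_measure)
    also have "(\<lambda>\<omega>. \<omega> b) -` {c\<in>{..<b}. (c + n) mod b = 0} \<inter> space (Omega B) =
        {\<omega> \<in> space (Omega B). (\<omega> b + n) mod b = 0}"
      using b by (auto simp: space_Omega)
    finally show "{\<omega> \<in> space (Omega B). (\<omega> b + n) mod b = 0} \<in> sets (Omega B)" .
  qed auto
  then show "(\<lambda>\<omega>. if \<exists>b\<in>B. (\<omega> b + n) mod b = 0 then 0 else 1)
      \<in> measurable (Omega B) (count_space {0, 1 :: nat})"
    by (intro measurable_If) auto
qed

lemma cylinder_in_sets:
  assumes "is_cylinder C"
  shows "C \<in> sets (\<Pi>\<^sub>M n\<in>{1..}. count_space {0, 1})"
proof -
  obtain F a where F: "finite F" "F \<subseteq> {1..}" "a \<in> F \<rightarrow> {0, 1}"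
    and C: "C = {x \<in> seq_space. \<forall>i\<in>F. x i = a i}"
    using assms by (auto simp: is_cylinder_def)
  have "C = prod_emb {1..} (\<lambda>n. count_space {0, 1}) F (\<Pi>\<^sub>E i\<in>F. {a i})"
  proof (rule set_eqI)
    fix x
    have "restrict x F \<in> (\<Pi>\<^sub>E i\<in>F. {a i}) \<longleftrightarrow> (\<forall>i\<in>F. x i = a i)"
      by (auto simp: restrict_PiE_iff Pi_iff)
    then show "x \<in> C \<longleftrightarrow> x \<in> prod_emb {1..} (\<lambda>n. count_space {0, 1}) F (\<Pi>\<^sub>E i\<in>F. {a i})"
      by (simp add: C seq_space_def prod_emb_def conj_commute del: PiE_singleton)
  qed
  also have "\<dots> \<in> sets (\<Pi>\<^sub>M n\<in>{1..}. count_space {0, 1})"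
    using F by (intro sets_PiM_I) auto
  finally show ?thesis .
qed

lemma measure_nu_cylinder:
  assumes "is_cylinder C"
  shows "measure (nu B) C = measure (Omega B) (phi B -` C \<inter> space (Omega B))"
  unfolding nu_def using cylinder_in_sets[OF assms] by (rule measure_distr[OF measurable_phi])

lemma image_vimage_aux: "f ` (S \<inter> f -` Y) = f ` S \<inter> Y"
  by auto

lemma Omega_translation_invariant:
  assumes B: "\<And>b. b \<in> B \<Longrightarrow> b \<ge> 2"
  shows "distr (Omega B) (Omega B) (\<lambda>\<omega>. \<lambda>b\<in>B. (\<omega> b + c b) mod b) = Omega B"
    (is "distr _ _ ?T = _")
proof -
  let ?U = "\<lambda>b. uniform_count_measure {..<b :: nat}"
  have ps: "prob_space (?U b)" if "b \<in> B" for b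
    using B[OF that] by (intro prob_space_uniform_count_measure) (auto simp: lessThan_empty_iff)
  interpret O: prob_space "Omega B" by (rule prob_space_Omega[OF B])
  have T: "?T \<in> measurable (Omega B) (Omega B)"
    unfolding Omega_def
  proof (rule measurable_restrict)
    fix b assume b: "b \<in> B"
    show "(\<lambda>\<omega>. (\<omega> b + c b) mod b) \<in> measurable (Pi\<^sub>M B ?U) (?U b)"
    proof (rule measurable_compose[OF measurable_component_singleton[OF b]])
      show "(\<lambda>x. (x + c b) mod b) \<in> measurable (?U b) (?U b)"
        using B[OF b]
        by (auto simp: measurable_def space_uniform_count_measure sets_uniform_count_measure)
    qed
  qed
  have inj: "inj_on (\<lambda>x. (x + c b) mod b) {..<b}" for b
  proof (rule inj_onI)
    fix x y assume xy: "x \<in> {..<b}" "y \<in> {..<b}" and "(x + c b) mod b = (y + c b) mod b"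
    then have "(int x + int (c b)) mod int b = (int y + int (c b)) mod int b"
      by (metis of_nat_add of_nat_mod)
    then have "(int x + int (c b) - int (c b)) mod int b = (int y + int (c b) - int (c b)) mod int b"
      by (rule mod_diff_cong) simp
    with xy show "x = y"
      by simp
  qed
  show ?thesis
  proof (rule measure_eqI_PiM_infinite[where I = B and M = ?U])
    fix A J
    assume J: "finite J" "J \<subseteq> B" and A: "\<And>i. i \<in> J \<Longrightarrow> A i \<in> sets (?U i)"
    have A': "A i \<subseteq> {..<i}" if "i \<in> J" for i
      using A[OF that] by (simp add: sets_uniform_count_measure)
    define A2 where "A2 i = {x\<in>{..<i}. (x + c i) mod i \<in> A i}" for i
    have card: "card (A2 i) = card (A i)" if "i \<in> J" for i
    proof -
      have "(\<lambda>x. (x + c i) mod i) ` {..<i} = {..<i}"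
        using inj[of i] B[of i] that J by (intro endo_inj_surj) auto
      then have "(\<lambda>x. (x + c i) mod i) ` ({..<i} \<inter> (\<lambda>x. (x + c i) mod i) -` A i) = A i"
        using A'[OF that] by (simp only: image_vimage_aux Int_absorb1)
      moreover have "A2 i = {..<i} \<inter> (\<lambda>x. (x + c i) mod i) -` A i"
        by (simp only: A2_def vimage_def Int_def mem_Collect_eq)
      ultimately have "(\<lambda>x. (x + c i) mod i) ` A2 i = A i"
        by (simp only:)
      moreover have "inj_on (\<lambda>x. (x + c i) mod i) (A2 i)"
        using inj[of i] by (rule inj_on_subset) (auto simp: A2_def)
      ultimately show ?thesis by (metis card_image)
    qed
    have "?T -` prod_emb B ?U J (Pi\<^sub>E J A) \<inter> space (Omega B) = prod_emb B ?U J (Pi\<^sub>E J A2)"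
      (is "?L = ?R")
    proof (rule set_eqI)
      fix \<omega>
      have "\<omega> \<in> ?R \<longleftrightarrow> \<omega> \<in> space (Omega B) \<and> (\<forall>i\<in>J. \<omega> i \<in> A2 i)"
        by (auto simp: prod_emb_def space_Omega space_uniform_count_measure PiE_iff)
      moreover have "?T \<omega> \<in> prod_emb B ?U J (Pi\<^sub>E J A) \<longleftrightarrow> (\<forall>i\<in>J. (\<omega> i + c i) mod i \<in> A i)"
        if "\<omega> \<in> space (Omega B)"
      proof -
        have "?T \<omega> \<in> space (Omega B)" using measurable_space[OF T that] .
        then have "?T \<omega> \<in> prod_emb B ?U J (Pi\<^sub>E J A) \<longleftrightarrow> (\<forall>i\<in>J. ?T \<omega> i \<in> A i)"
          by (auto simp: prod_emb_def space_Omega space_uniform_count_measure PiE_iff)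
        then show ?thesis using J by (auto simp: subset_eq)
      qed
      moreover have "\<omega> i \<in> {..<i}" if "\<omega> \<in> space (Omega B)" "i \<in> J" for i
        using that J by (auto simp: space_Omega)
      ultimately show "\<omega> \<in> ?L \<longleftrightarrow> \<omega> \<in> ?R"
        by (cases "\<omega> \<in> space (Omega B)") (simp_all add: A2_def)
    qed
    moreover have "prod_emb B ?U J (Pi\<^sub>E J A) \<in> sets (Omega B)"
      unfolding Omega_def using J A by (intro sets_PiM_I) auto
    ultimately have "emeasure (distr (Omega B) (Omega B) ?T) (prod_emb B ?U J (Pi\<^sub>E J A)) =
        emeasure (Omega B) (prod_emb B ?U J (Pi\<^sub>E J A2))"
      by (simp add: emeasure_distr[OF T])
    also have "\<dots> = (\<Prod>i\<in>J. emeasure (?U i) (A2 i))"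
      unfolding Omega_def using J ps
      by (intro emeasure_PiM_emb) (auto simp: A2_def sets_uniform_count_measure)
    also have "\<dots> = (\<Prod>i\<in>J. emeasure (?U i) (A i))"
    proof (rule prod.cong)
      fix i assume "i \<in> J"
      moreover have "A2 i \<subseteq> {..<i}"
        by (auto simp: A2_def)
      ultimately show "emeasure (?U i) (A2 i) = emeasure (?U i) (A i)"
        using card[of i] A'[of i] by (simp add: emeasure_uniform_count_measure)
    qed simp
    also have "\<dots> = emeasure (Omega B) (prod_emb B ?U J (Pi\<^sub>E J A))"
      unfolding Omega_def using J A ps by (intro emeasure_PiM_emb[symmetric]) auto
    finally show "emeasure (distr (Omega B) (Omega B) ?T) (prod_emb B ?U J (Pi\<^sub>E J A)) =
        emeasure (Omega B) (prod_emb B ?U J (Pi\<^sub>E J A))" .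
  next
    show "finite_measure (distr (Omega B) (Omega B) ?T)"
      by (rule finite_measure.finite_measure_distr[OF O.finite_measure_axioms T])
  qed (auto simp: Omega_def)
qed

end

theory Submission
  imports Defs "HOL-Number_Theory.Cong"
begin

text \<open>
  Replace \<open>B\<close> by a finite subset \<open>K\<close> with product \<open>Q\<close>. Whether the \<open>k\<close>-th shift of the truncated
  sequence lies in \<open>C\<close> depends only on \<open>k\<close> modulo \<open>Q\<close>, and its mean over a period is the truncated
  measure of \<open>C\<close>, by the Chinese remainder theorem. At most one element of \<open>B\<close> is divisible by
  \<open>p\<close>, so for a suitable \<open>m\<close> the power \<open>p ^ (m + 1)\<close> divides no such \<open>Q\<close>; then \<open>p ^ m\<close> is a
  multiple of \<open>p ^ s\<close> modulo \<open>Q\<close>, which makes the numbers \<open>n * p ^ s + r\<close> with \<open>r < p ^ m\<close>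
  equidistributed modulo \<open>Q\<close>. The error of the truncation is at most a constant, depending on
  \<open>s\<close> and \<open>C\<close>, times the tail of the convergent series of reciprocals.
\<close>

section \<open>Averages of periodic functions on the natural numbers\<close>

text \<open>Moving the window by one trades the term \<open>f x\<close> for the equal term
  \<open>f (x + Q)\<close>.\<close>

lemma periodic_sum_shift:
  fixes f :: "nat \<Rightarrow> real"
  assumes "\<And>k. f (k + Q) = f k"
  shows "(\<Sum>k<Q. f (k + x)) = (\<Sum>k<Q. f k)"
proof (induction x)
  case (Suc x)
  have "(\<Sum>k<Q. f (k + Suc x)) = (\<Sum>k<Q. f (Suc k + x))"
    by simp
  also have "\<dots> = (\<Sum>k<Suc Q. f (k + x)) - f x"
    by (subst sum.lessThan_Suc_shift) simp
  also have "\<dots> = (\<Sum>k<Q. f (k + x))"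
    using assms[of x] by (simp add: add.commute)
  finally show ?case
    using Suc by simp
qed simp

lemma periodic_mult:
  assumes "\<And>k. f (k + Q) = f k"
  shows "f (k + j * Q) = f (k :: nat)"
proof (induction j)
  case (Suc j)
  then show ?case
    using assms[of "k + j * Q"] by (simp add: algebra_simps)
qed simp

lemma periodic_cong:
  assumes "\<And>k. f (k + Q) = f k" and "[x = y] (mod Q)"
  shows "f x = f (y :: nat)"
proof -
  have "f z = f (z mod Q)" for z
    using periodic_mult[of f Q "z mod Q" "z div Q", OF assms(1)] by simp
  with assms(2) show ?thesis
    by (metis cong_def)
qed

text \<open>The partial sums minus \<open>N\<close> times the mean over a period are themselves
  periodic in \<open>N\<close>, hence bounded, and division by \<open>N\<close> removes them in the
  limit.\<close>

lemma periodic_average_tendsto: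
  fixes f :: "nat \<Rightarrow> real"
  assumes per: "\<And>k. f (k + Q) = f k" and "Q > 0"
  shows "(\<lambda>N. 1 / real N * (\<Sum>n<N. f n)) \<longlonglongrightarrow> 1 / real Q * (\<Sum>n<Q. f n)"
proof -
  define A where "A = 1 / real Q * (\<Sum>n<Q. f n)"
  define h where "h N = (\<Sum>n<N. f n) - real N * A" for N
  have h_per: "h (N + Q) = h N" for N
  proof -
    have "(\<Sum>n<N + Q. f n) = (\<Sum>n<N. f n) + (\<Sum>k<Q. f (k + N))"
      by (induction Q) (simp_all add: add.commute)
    then show ?thesis
      using periodic_sum_shift[of f Q N] per \<open>Q > 0\<close> by (simp add: h_def A_def field_simps)
  qed
  have "h N \<in> h ` {..<Q}" for N
    using periodic_cong[of h Q N "N mod Q", OF h_per] \<open>Q > 0\<close> by (simp add: cong_def)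
  then have "range h \<subseteq> h ` {..<Q}"
    by blast
  then have "bounded (range h)"
    by (meson finite_imageI finite_imp_bounded finite_lessThan finite_subset)
  then obtain c where c: "\<And>N. \<bar>h N\<bar> \<le> c"
    by (auto simp: bounded_iff)
  have "(\<lambda>N. inverse (real N) * h N) \<longlonglongrightarrow> 0"
  proof (rule tendsto_0_le[OF lim_inverse_n])
    show "\<forall>\<^sub>F N in sequentially. norm (inverse (real N) * h N) \<le> norm (inverse (real N)) * c"
      using c by (intro always_eventually allI) (simp add: abs_mult mult_left_mono)
  qed
  then have "(\<lambda>N. inverse (real N) * h N + A) \<longlonglongrightarrow> 0 + A"
    by (intro tendsto_intros)
  moreover have "\<forall>\<^sub>F N in sequentially. inverse (real N) * h N + A = 1 / real N * (\<Sum>n<N. f n)"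
    using eventually_gt_at_top[of 0] by eventually_elim (simp add: h_def field_simps)
  ultimately have "(\<lambda>N. 1 / real N * (\<Sum>n<N. f n)) \<longlonglongrightarrow> 0 + A"
    by (rule Lim_transform_eventually)
  then show ?thesis
    by (simp add: A_def)
qed

text \<open>
  Translating the argument by \<open>1\<close> changes the double sum by a difference of two sums over \<open>n\<close>
  whose arguments differ by \<open>P\<close>; since \<open>P\<close> is a multiple of \<open>q\<close> modulo \<open>Q\<close>, this difference
  vanishes, and so the double sum equals its average over all translates.
\<close>

lemma periodic_double_sum:
  fixes f :: "nat \<Rightarrow> real"
  assumes per: "\<And>k. f (k + Q) = f k" and t: "[t * q = P] (mod Q)" and "Q > 0"
  shows "(\<Sum>r<P. \<Sum>n<Q. f (n * q + r)) = real P * (\<Sum>k<Q. f k)"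
proof -
  define G where "G x = (\<Sum>n<Q. \<Sum>r<P. f (n * q + r + x))" for x
  have G_Suc: "G (Suc x) = G x" for x
  proof -
    have "(\<Sum>n<Q. f (n * q + P + x)) = (\<Sum>n<Q. f ((n + t) * q + x))"
    proof (rule sum.cong)
      fix n
      have "[n * q + P + x = n * q + t * q + x] (mod Q)"
        using t by (intro cong_add cong_refl) (rule cong_sym)
      then show "f (n * q + P + x) = f ((n + t) * q + x)"
        using periodic_cong[of f Q, OF per] by (simp add: distrib_right)
    qed simp
    also have "\<dots> = (\<Sum>n<Q. f (n * q + x))"
    proof (rule periodic_sum_shift[where f = "\<lambda>n. f (n * q + x)"])
      show "f ((k + Q) * q + x) = f (k * q + x)" for k
        using periodic_mult[of f Q "k * q + x" q, OF per] by (simp add: algebra_simps)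
    qed
    finally have "(\<Sum>n<Q. f (n * q + P + x)) = (\<Sum>n<Q. f (n * q + x))" .
    moreover have "(\<Sum>r<P. f (n * q + r + Suc x)) =
        (\<Sum>r<P. f (n * q + r + x)) + f (n * q + P + x) - f (n * q + x)" for n
      using sum.lessThan_Suc_shift[of "\<lambda>r. f (n * q + r + x)" P] by simp
    ultimately show ?thesis
      by (simp add: G_def sum.distrib sum_subtractf)
  qed
  have G_const: "G x = G 0" for x
    by (induction x) (simp_all add: G_Suc)
  have swap: "(\<Sum>x<Q. \<Sum>r<P. f (n * q + r + x)) = (\<Sum>r<P. \<Sum>x<Q. f (x + (n * q + r)))" for n
    by (subst sum.swap) (simp add: add.commute)
  have "real Q * G 0 = (\<Sum>x<Q. G 0)"
    by simp
  also have "\<dots> = (\<Sum>x<Q. G x)"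
    by (intro sum.cong refl G_const[symmetric])
  also have "\<dots> = (\<Sum>n<Q. \<Sum>x<Q. \<Sum>r<P. f (n * q + r + x))"
    unfolding G_def by (rule sum.swap)
  also have "\<dots> = (\<Sum>n<Q. \<Sum>r<P. \<Sum>x<Q. f (x + (n * q + r)))"
    by (simp only: swap)
  \<comment> \<open>Each inner sum over \<open>x\<close> runs through a full period, so it depends
    on neither \<open>n\<close> nor \<open>r\<close>.\<close>
  also have "\<dots> = real Q * (real P * (\<Sum>k<Q. f k))"
    by (simp add: periodic_sum_shift[of f Q] per)
  finally have "G 0 = real P * (\<Sum>k<Q. f k)"
    using \<open>Q > 0\<close> by simp
  then show ?thesis
    by (subst sum.swap) (simp add: G_def)
qed

section \<open>Counting multiples, and tails of the series of reciprocals\<close>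

text \<open>Counting from 1 gives exactly \<open>M div b\<close> multiples of \<open>b\<close>, with
  no rounding term, and only the finitely many \<open>b \<le> M\<close> contribute. Hence the bound
  survives for infinite \<open>D\<close>.\<close>

lemma card_multiples_le:
  fixes D :: "nat set"
  assumes D: "\<And>b. b \<in> D \<Longrightarrow> b > 0" and summ: "(\<lambda>b. 1 / real b) summable_on D"
  shows "real (card {k \<in> {1..M}. \<exists>b\<in>D. b dvd k}) \<le> real M * infsum (\<lambda>b. 1 / real b) D"
proof -
  define J where "J = {b \<in> D. b \<le> M}"
  have "finite J"
    by (simp add: J_def)
  have "card {k \<in> {1..M}. b dvd k} = M div b" if "b \<in> J" for b
  proof -
    have "b > 0"
      using D[of b] that by (simp add: J_def)
    have "{k \<in> {1..M}. b dvd k} = (\<lambda>j. b * j) ` {1..M div b}"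
      using \<open>b > 0\<close> by (auto simp: less_eq_div_iff_mult_less_eq mult.commute elim!: dvdE)
    moreover have "inj_on (\<lambda>j. b * j) {1..M div b}"
      using \<open>b > 0\<close> by (auto simp: inj_on_def)
    ultimately show ?thesis
      by (simp add: card_image)
  qed
  note card_b = this
  have "{k \<in> {1..M}. \<exists>b\<in>D. b dvd k} \<subseteq> (\<Union>b\<in>J. {k \<in> {1..M}. b dvd k})"
    by (fastforce simp: J_def dest: dvd_imp_le)
  then have "card {k \<in> {1..M}. \<exists>b\<in>D. b dvd k} \<le> card (\<Union>b\<in>J. {k \<in> {1..M}. b dvd k})"
    using \<open>finite J\<close> by (intro card_mono) auto
  also have "\<dots> \<le> (\<Sum>b\<in>J. card {k \<in> {1..M}. b dvd k})"
    using \<open>finite J\<close> by (rule card_UN_le)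
  also have "\<dots> = (\<Sum>b\<in>J. M div b)"
    by (intro sum.cong refl card_b)
  finally have "real (card {k \<in> {1..M}. \<exists>b\<in>D. b dvd k}) \<le> (\<Sum>b\<in>J. real (M div b))"
    by (simp only: of_nat_le_iff flip: of_nat_sum)
  also have "\<dots> \<le> (\<Sum>b\<in>J. real M * (1 / real b))"
    using of_nat_div_le_of_nat[where 'a = real] by (intro sum_mono) simp
  also have "\<dots> = real M * (\<Sum>b\<in>J. 1 / real b)"
    by (simp add: sum_distrib_left)
  also have "\<dots> \<le> real M * infsum (\<lambda>b. 1 / real b) D"
    using summ \<open>finite J\<close> by (intro mult_left_mono finite_sum_le_infsum) (auto simp: J_def)
  finally show ?thesis .
qed

lemma small_tail:
  fixes f :: "'a \<Rightarrow> real"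
  assumes "f summable_on A" and "\<epsilon> > 0"
  obtains K where "finite K" "K \<subseteq> A" "infsum f (A - K) < \<epsilon>"
proof -
  obtain K where K: "finite K" "K \<subseteq> A" "dist (sum f K) (infsum f A) \<le> \<epsilon> / 2"
    using infsum_finite_approximation[OF assms(1), of "\<epsilon> / 2"] assms(2) by auto
  have "infsum f (A - K) = infsum f A - infsum f K"
    using K assms(1) by (intro infsum_Diff) auto
  moreover have "infsum f A - sum f K \<le> \<epsilon> / 2"
    using K(3) unfolding dist_real_def by linarith
  ultimately have "infsum f (A - K) < \<epsilon>"
    using K(1) assms(2) by simp
  with K show thesis
    using that by blast
qed

section \<open>Patterns on finite windows, for orbit points and for points of
  \<open>Omega B\<close>\<close>

text \<open>
  The \<open>k\<close>-th shift of \<open>eta B\<close> is the image under \<open>phi B\<close> of the diagonal element given by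
  \<open>k\<close>, so the constant function \<open>\<lambda>_. k\<close> in place of \<open>\<omega>\<close> describes the orbit of \<open>eta B\<close>.
\<close>

definition pattern_at :: "nat set \<Rightarrow> nat set \<Rightarrow> (nat \<Rightarrow> nat) \<Rightarrow> (nat \<Rightarrow> nat) \<Rightarrow> bool" where
  "pattern_at K F a \<omega> \<longleftrightarrow> (\<forall>i\<in>F. (if \<exists>b\<in>K. (\<omega> b + i) mod b = 0 then 0 else 1) = a i)"

lemma pattern_at_cong:
  assumes "\<And>b. b \<in> K \<Longrightarrow> [\<omega> b = \<omega>' b] (mod b)"
  shows "pattern_at K F a \<omega> = pattern_at K F a \<omega>'"
proof -
  have "(\<omega> b + i) mod b = (\<omega>' b + i) mod b" if "b \<in> K" for b i
    using assms[OF that] by (metis cong_add_rcancel_nat cong_def)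
  then show ?thesis
    by (simp add: pattern_at_def)
qed

text \<open>Passing from \<open>K\<close> to \<open>B\<close> can only turn ones into zeros, and
  each such change has a witness in \<open>B - K\<close>. Both truncation errors, for the measure
  and for the orbit averages, are controlled through these witnesses.\<close>

lemma pattern_at_truncate:
  assumes "pattern_at B F a \<omega> \<noteq> pattern_at K F a \<omega>" and "K \<subseteq> B"
  shows "\<exists>i\<in>F. \<exists>b\<in>B - K. (\<omega> b + i) mod b = 0"
proof (rule ccontr)
  assume "\<not> ?thesis"
  then have "(\<omega> b + i) mod b \<noteq> 0" if "i \<in> F" "b \<in> B" "b \<notin> K" for i b
    using that by simp
  then have "(\<exists>b\<in>B. (\<omega> b + i) mod b = 0) = (\<exists>b\<in>K. (\<omega> b + i) mod b = 0)" if "i \<in> F" for i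
    using that assms(2) by (meson subsetD)
  then have "pattern_at B F a \<omega> = pattern_at K F a \<omega>"
    by (simp add: pattern_at_def)
  with assms(1) show False
    by simp
qed

lemma seq_shift_funpow_eta:
  assumes "i \<ge> 1"
  shows "(seq_shift ^^ k) (eta B) i = eta B (i + k)"
  using assms by (induction k arbitrary: i) (simp_all add: seq_shift_def)

lemma seq_shift_funpow_eta_mem:
  assumes "F \<subseteq> {1..}"
  shows "(seq_shift ^^ k) (eta B) \<in> {x \<in> seq_space. \<forall>i\<in>F. x i = a i} \<longleftrightarrow>
    pattern_at B F a (\<lambda>_. k)"
proof -
  have "(seq_shift ^^ k) (eta B) \<in> seq_space"
    by (induction k) (simp_all add: eta_in_seq_space seq_shift_in_seq_space)
  moreover have "(seq_shift ^^ k) (eta B) i = (if \<exists>b\<in>B. (k + i) mod b = 0 then 0 else 1)"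
    if "i \<in> F" for i
    using that assms by (subst seq_shift_funpow_eta) (auto simp: eta_def dvd_eq_mod_eq_0 add.commute)
  ultimately show ?thesis
    by (simp add: pattern_at_def)
qed

lemma phi_mem:
  assumes "F \<subseteq> {1..}"
  shows "phi B \<omega> \<in> {x \<in> seq_space. \<forall>i\<in>F. x i = a i} \<longleftrightarrow> pattern_at B F a \<omega>"
proof -
  have "phi B \<omega> \<in> seq_space"
    by (auto simp: phi_def seq_space_def)
  moreover have "phi B \<omega> i = (if \<exists>b\<in>B. (\<omega> b + i) mod b = 0 then 0 else 1)" if "i \<in> F" for i
    using that assms by (auto simp: phi_def)
  ultimately show ?thesis
    by (simp add: pattern_at_def)
qed

lemma pattern_at_const_periodic:
  assumes "finite K"
  shows "pattern_at K F a (\<lambda>_. k + \<Prod>K) = pattern_at K F a (\<lambda>_. k)"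
proof (rule pattern_at_cong)
  fix b assume "b \<in> K"
  then have "b dvd \<Prod>K"
    using dvd_prodI[OF assms, of b "\<lambda>b. b"] by simp
  then show "[k + \<Prod>K = k] (mod b)"
    by (metis add.right_neutral cong_0_iff cong_add_lcancel_nat)
qed

section \<open>Measures of patterns in \<open>Omega B\<close>\<close>

lemma sets_residue:
  assumes "b \<in> B"
  shows "{\<omega> \<in> space (Omega B). (\<omega> b + n) mod b = 0} \<in> sets (Omega B)"
proof -
  have "(\<lambda>\<omega>. \<omega> b) \<in> measurable (Omega B) (uniform_count_measure {..<b})"
    unfolding Omega_def using assms by (rule measurable_component_singleton)
  then have "(\<lambda>\<omega>. \<omega> b) -` {c\<in>{..<b}. (c + n) mod b = 0} \<inter> space (Omega B) \<in> sets (Omega B)"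
    by (rule measurable_sets) (auto simp: sets_uniform_count_measure)
  also have "(\<lambda>\<omega>. \<omega> b) -` {c\<in>{..<b}. (c + n) mod b = 0} \<inter> space (Omega B) =
      {\<omega> \<in> space (Omega B). (\<omega> b + n) mod b = 0}"
    using assms by (auto simp: space_Omega)
  finally show ?thesis .
qed

lemma sets_pattern_at:
  assumes "finite F" and "K \<subseteq> B"
  shows "{\<omega> \<in> space (Omega B). pattern_at K F a \<omega>} \<in> sets (Omega B)"
  unfolding pattern_at_def
proof (rule sets.sets_Collect_finite_All[OF _ assms(1)])
  fix i
  have E: "{\<omega> \<in> space (Omega B). \<exists>b\<in>K. (\<omega> b + i) mod b = 0} \<in> sets (Omega B)"
    using assms(2) by (intro sets.sets_Collect_countable_Ex' sets_residue) auto
  have "((if Q then 0 else 1) = a i) \<longleftrightarrow> Q \<and> a i = 0 \<or> \<not> Q \<and> a i = 1" for Q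
    by auto
  then show "{\<omega> \<in> space (Omega B). (if \<exists>b\<in>K. (\<omega> b + i) mod b = 0 then 0 else 1) = a i} \<in> sets (Omega B)"
    by (simp only:) (intro sets.sets_Collect E)
qed

text \<open>By the Chinese remainder theorem \<open>\<omega>\<close> agrees on \<open>K\<close> with
  a single integer \<open>x\<close>, so its translates are diagonal points running through one full
  period. The sum is therefore constant in \<open>\<omega>\<close>.\<close>

lemma pattern_at_sum_translates:
  assumes "finite K" and "pairwise coprime K"
  shows "(\<Sum>k<\<Prod>K. of_bool (pattern_at K F a (\<lambda>b. \<omega> b + k))) =
    (\<Sum>k<\<Prod>K. of_bool (pattern_at K F a (\<lambda>_. k)) :: real)"
proof -
  obtain x where x: "\<And>b. b \<in> K \<Longrightarrow> [x = \<omega> b] (mod b)"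
    using chinese_remainder_nat[of K "\<lambda>b. b" \<omega>] assms by (auto simp: pairwise_def)
  have "pattern_at K F a (\<lambda>b. \<omega> b + k) = pattern_at K F a (\<lambda>_. k + x)" for k
  proof (rule pattern_at_cong)
    show "[\<omega> b + k = k + x] (mod b)" if "b \<in> K" for b
      using cong_sym[OF x[OF that]] by (simp add: add.commute cong_add_lcancel_nat)
  qed
  then show ?thesis
    using periodic_sum_shift[of "\<lambda>k. of_bool (pattern_at K F a (\<lambda>_. k))" "\<Prod>K" x]
      pattern_at_const_periodic[OF assms(1)] by simp
qed

lemma measure_pattern_at_translate:
  assumes B: "\<And>b. b \<in> B \<Longrightarrow> b \<ge> 2" and "finite F" "K \<subseteq> B"
  shows "{\<omega> \<in> space (Omega B). pattern_at K F a (\<lambda>b. \<omega> b + k)} \<in> sets (Omega B)" (is ?S)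
    and "measure (Omega B) {\<omega> \<in> space (Omega B). pattern_at K F a (\<lambda>b. \<omega> b + k)} =
      measure (Omega B) {\<omega> \<in> space (Omega B). pattern_at K F a \<omega>}" (is ?M)
proof -
  let ?T = "\<lambda>\<omega>. \<lambda>b\<in>B. (\<omega> b + k) mod b"
  let ?E = "{\<omega> \<in> space (Omega B). pattern_at K F a \<omega>}"
  have T: "?T \<in> measurable (Omega B) (Omega B)"
    unfolding Omega_def
  proof (rule measurable_restrict)
    fix b assume b: "b \<in> B"
    show "(\<lambda>\<omega>. (\<omega> b + k) mod b) \<in> measurable (\<Pi>\<^sub>M b\<in>B. uniform_count_measure {..<b})
        (uniform_count_measure {..<b})"
      using B[OF b]
      by (intro measurable_compose[OF measurable_component_singleton[OF b]])
        (auto simp: measurable_def space_uniform_count_measure sets_uniform_count_measure)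
  qed
  \<comment> \<open>Reducing modulo \<open>b\<close> and restricting to \<open>B\<close> keep
    \<open>?T\<close> inside the space; the pattern on \<open>K\<close> sees neither.\<close>
  have "pattern_at K F a (?T \<omega>) = pattern_at K F a (\<lambda>b. \<omega> b + k)" for \<omega>
    using assms(3) by (intro pattern_at_cong) (auto simp: cong_def)
  then have eq: "?T -` ?E \<inter> space (Omega B) =
      {\<omega> \<in> space (Omega B). pattern_at K F a (\<lambda>b. \<omega> b + k)}"
    using measurable_space[OF T] by auto
  have E: "?E \<in> sets (Omega B)"
    using assms by (intro sets_pattern_at)
  from measurable_sets[OF T E] show ?S
    by (simp only: eq)
  have "measure (Omega B) ?E = measure (distr (Omega B) (Omega B) ?T) ?E"
    using Omega_translation_invariant[of B "\<lambda>_. k"] B by simp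
  also have "\<dots> = measure (Omega B) (?T -` ?E \<inter> space (Omega B))"
    by (rule measure_distr[OF T E])
  finally show ?M
    by (simp only: eq)
qed

text \<open>The indicators of the \<open>\<Prod>K\<close> translated events are summed and
  integrated. Translation invariance gives all of them the same integral, while their sum is
  constant at every point.\<close>

lemma measure_pattern_at_finite:
  assumes B: "\<And>b. b \<in> B \<Longrightarrow> b \<ge> 2" and "finite F" "K \<subseteq> B" "finite K" "pairwise coprime K"
  shows "measure (Omega B) {\<omega> \<in> space (Omega B). pattern_at K F a \<omega>} =
    1 / real (\<Prod>K) * (\<Sum>k<\<Prod>K. of_bool (pattern_at K F a (\<lambda>_. k)))"
proof -
  interpret prob_space "Omega B"
    using B by (rule prob_space_Omega)
  let ?E = "\<lambda>k. {\<omega> \<in> space (Omega B). pattern_at K F a (\<lambda>b. \<omega> b + k)}"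
  let ?c = "\<Sum>k<\<Prod>K. of_bool (pattern_at K F a (\<lambda>_. k)) :: real"
  note [measurable] = measure_pattern_at_translate(1)[OF assms(1-3)]
  have "real (\<Prod>K) * prob {\<omega> \<in> space (Omega B). pattern_at K F a \<omega>} = (\<Sum>k<\<Prod>K. prob (?E k))"
    by (simp add: measure_pattern_at_translate(2)[OF assms(1-3)])
  also have "\<dots> = (\<integral>\<omega>. (\<Sum>k<\<Prod>K. indicator (?E k) \<omega>) \<partial>Omega B)"
    by (subst Bochner_Integration.integral_sum) (auto simp: emeasure_eq_measure)
  also have "\<dots> = (\<integral>\<omega>. ?c \<partial>Omega B)"
  proof (rule Bochner_Integration.integral_cong)
    fix \<omega> assume "\<omega> \<in> space (Omega B)"
    then show "(\<Sum>k<\<Prod>K. indicator (?E k) \<omega>) = ?c"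
      using pattern_at_sum_translates[of K F a \<omega>] assms by (simp add: indicator_def)
  qed simp
  also have "\<dots> = ?c"
    by (simp add: prob_space)
  finally have "real (\<Prod>K) * prob {\<omega> \<in> space (Omega B). pattern_at K F a \<omega>} = ?c" .
  moreover have "0 \<notin> K"
    using assms(1)[of 0] assms(3) by auto
  ultimately show ?thesis
    using \<open>finite K\<close> by (simp add: field_simps del: of_nat_prod)
qed

text \<open>This is the finite formula for the window \<open>{i}\<close>, the single modulus
  \<open>b\<close> and the prescribed value 0; among \<open>b\<close> consecutive integers exactly
  one is a multiple of \<open>b\<close>.\<close>

lemma measure_residue:
  assumes B: "\<And>b. b \<in> B \<Longrightarrow> b \<ge> 2" and "b \<in> B"
  shows "measure (Omega B) {\<omega> \<in> space (Omega B). (\<omega> b + i) mod b = 0} = 1 / real b"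
proof -
  have "(\<Sum>k<b. of_bool (b dvd k + i)) = (\<Sum>k<b. of_bool (b dvd k) :: real)"
    by (rule periodic_sum_shift) simp
  also have "\<dots> = (\<Sum>k\<in>{0::nat}. 1)"
    using B[OF assms(2)] by (intro sum.mono_neutral_cong_right) (auto dest: dvd_imp_le)
  finally have "(\<Sum>k<b. of_bool (b dvd k + i)) = (1 :: real)"
    by simp
  moreover have "(if P then 0 else 1) = (0 :: nat) \<longleftrightarrow> P" for P
    by simp
  ultimately show ?thesis
    using measure_pattern_at_finite[of B "{i}" "{b}" "\<lambda>_. 0"] B assms(2)
    by (simp add: pattern_at_def dvd_eq_mod_eq_0)
qed

text \<open>Countable subadditivity is stated for sequences, so the infinite set \<open>D\<close> is
  enumerated bijectively and the unordered sum becomes a series.\<close>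

lemma measure_residue_UN_le:
  assumes B: "\<And>b. b \<in> B \<Longrightarrow> b \<ge> 2" and "D \<subseteq> B" "infinite D"
    and summ: "(\<lambda>b. 1 / real b) summable_on D"
  shows "measure (Omega B) (\<Union>b\<in>D. {\<omega> \<in> space (Omega B). (\<omega> b + i) mod b = 0})
    \<le> infsum (\<lambda>b. 1 / real b) D"
proof -
  interpret prob_space "Omega B"
    using B by (rule prob_space_Omega)
  define e where "e = from_nat_into D"
  let ?A = "\<lambda>b. {\<omega> \<in> space (Omega B). (\<omega> b + i) mod b = 0}"
  have bij: "bij_betw e UNIV D"
    using \<open>infinite D\<close> unfolding e_def by (intro bij_betw_from_nat_into) auto
  then have e: "e n \<in> D" "e n \<in> B" for n
    using \<open>D \<subseteq> B\<close> by (auto simp: bij_betw_def)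
  have "((\<lambda>b. 1 / real b) has_sum infsum (\<lambda>b. 1 / real b) D) D"
    using summ by (rule has_sum_infsum)
  then have "((\<lambda>n. 1 / real (e n)) has_sum infsum (\<lambda>b. 1 / real b) D) UNIV"
    using has_sum_reindex_bij_betw[OF bij, of "\<lambda>b. 1 / real b"] by simp
  then have sums: "(\<lambda>n. prob (?A (e n))) sums infsum (\<lambda>b. 1 / real b) D"
    using e by (simp add: measure_residue[OF B] has_sum_imp_sums)
  have "prob (\<Union>n. ?A (e n)) \<le> (\<Sum>n. prob (?A (e n)))"
    using sums e by (intro finite_measure_subadditive_countably) (auto intro: sets_residue simp: sums_iff)
  also have "(\<Union>n. ?A (e n)) = (\<Union>b\<in>D. ?A b)"
    using bij by (auto simp: bij_betw_def)
  finally show ?thesis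
    using sums by (simp add: sums_iff)
qed

text \<open>The two events differ only inside the union \<open>U\<close> of the residue events for
  \<open>i \<in> F\<close> and \<open>b \<in> B - K\<close>, and the union bound applies to
  \<open>U\<close>.\<close>

lemma measure_pattern_at_truncate:
  assumes B: "\<And>b. b \<in> B \<Longrightarrow> b \<ge> 2" and "K \<subseteq> B" "infinite (B - K)" "finite F"
    and summ: "(\<lambda>b. 1 / real b) summable_on B"
  shows "\<bar>measure (Omega B) {\<omega> \<in> space (Omega B). pattern_at B F a \<omega>} -
      measure (Omega B) {\<omega> \<in> space (Omega B). pattern_at K F a \<omega>}\<bar>
    \<le> real (card F) * infsum (\<lambda>b. 1 / real b) (B - K)"
proof -
  interpret prob_space "Omega B"
    using B by (rule prob_space_Omega)
  let ?E = "\<lambda>K. {\<omega> \<in> space (Omega B). pattern_at K F a \<omega>}"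
  let ?A = "\<lambda>i. \<Union>b\<in>B - K. {\<omega> \<in> space (Omega B). (\<omega> b + i) mod b = 0}"
  have sets: "?E B \<in> sets (Omega B)" "?E K \<in> sets (Omega B)"
    using assms by (auto intro: sets_pattern_at)
  have setsA: "?A i \<in> sets (Omega B)" for i
    by (intro sets.countable_UN') (auto intro: sets_residue)
  define U where "U = (\<Union>i\<in>F. ?A i)"
  have setsU: "U \<in> sets (Omega B)"
    unfolding U_def by (intro sets.finite_UN \<open>finite F\<close> setsA)
  have le: "prob X \<le> prob Y + prob U"
    if "X \<in> sets (Omega B)" "Y \<in> sets (Omega B)" "X \<subseteq> Y \<union> U" for X Y
  proof -
    have "prob X \<le> prob (Y \<union> U)"
      using that setsU by (intro finite_measure_mono) auto
    also have "\<dots> \<le> prob Y + prob U"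
      using that setsU by (intro measure_Un_le)
    finally show ?thesis .
  qed
  have "\<omega> \<in> U" if "\<omega> \<in> space (Omega B)" "pattern_at B F a \<omega> \<noteq> pattern_at K F a \<omega>" for \<omega>
    using pattern_at_truncate[OF that(2) assms(2)] that(1) by (auto simp: U_def)
  then have "?E B \<subseteq> ?E K \<union> U" "?E K \<subseteq> ?E B \<union> U"
    by auto
  then have "\<bar>prob (?E B) - prob (?E K)\<bar> \<le> prob U"
    using le[of "?E B" "?E K"] le[of "?E K" "?E B"] sets by linarith
  also have "\<dots> \<le> (\<Sum>i\<in>F. prob (?A i))"
    unfolding U_def using \<open>finite F\<close> setsA
    by (intro finite_measure_subadditive_finite image_subsetI)
  also have "\<dots> \<le> (\<Sum>i\<in>F. infsum (\<lambda>b. 1 / real b) (B - K))"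
    using assms by (intro sum_mono measure_residue_UN_le summable_on_subset_banach[OF summ]) auto
  finally show ?thesis
    by simp
qed

section \<open>Averages along progressions in the orbit of \<open>eta B\<close>\<close>

text \<open>
  The arguments \<open>n * q + r + i\<close> are distinct integers below \<open>N * (q + r + i)\<close>, so multiples of \<open>b\<close>
  are counted among all integers of that range. The resulting loss of a factor about \<open>q\<close> is
  harmless, because the tail of the series is chosen after \<open>q\<close>.
\<close>

lemma average_pattern_at_truncate:
  assumes B: "\<And>b. b \<in> B \<Longrightarrow> b \<ge> 2" and "K \<subseteq> B" and F: "finite F" "F \<subseteq> {1..}"
    and summ: "(\<lambda>b. 1 / real b) summable_on B" and "q > 0" "N > 0"
  shows "\<bar>1 / real N * (\<Sum>n<N. of_bool (pattern_at B F a (\<lambda>_. n * q + r))) -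
      1 / real N * (\<Sum>n<N. of_bool (pattern_at K F a (\<lambda>_. n * q + r)))\<bar>
    \<le> real (\<Sum>i\<in>F. q + r + i) * infsum (\<lambda>b. 1 / real b) (B - K)"
proof -
  let ?T = "infsum (\<lambda>b. 1 / real b) (B - K)"
  let ?h = "\<lambda>i n. \<exists>b\<in>B - K. b dvd n * q + r + i"
  let ?f = "\<lambda>K n. of_bool (pattern_at K F a (\<lambda>_. n * q + r)) :: real"
  have summ': "(\<lambda>b. 1 / real b) summable_on (B - K)"
    using summ by (rule summable_on_subset_banach) auto
  have pos: "b > 0" if "b \<in> B - K" for b
    using B[of b] that by auto
  have count: "(\<Sum>n<N. of_bool (?h i n)) \<le> real N * (real (q + r + i) * ?T)" if "i \<in> F" for i
  proof -
    let ?M = "N * (q + r + i)"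
    \<comment> \<open>Positivity of \<open>i\<close> keeps the argument away from 0, which every
      \<open>b\<close> divides; this matters when \<open>n = r = 0\<close>.\<close>
    have i: "i \<ge> 1"
      using that F by auto
    have bound: "n * q + r + i \<le> ?M" if "n < N" for n
    proof -
      have "n * q + r + i \<le> N * q + N * r + N * i"
        using that \<open>N > 0\<close> by (intro add_mono mult_right_mono) auto
      then show ?thesis
        by (simp add: algebra_simps)
    qed
    have "inj_on (\<lambda>n. n * q + r + i) {n\<in>{..<N}. ?h i n}"
      using \<open>q > 0\<close> by (auto simp: inj_on_def)
    then have "card {n\<in>{..<N}. ?h i n} = card ((\<lambda>n. n * q + r + i) ` {n\<in>{..<N}. ?h i n})"
      by (simp add: card_image)
    also have "\<dots> \<le> card {k \<in> {1..?M}. \<exists>b\<in>B - K. b dvd k}"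
      using bound i by (intro card_mono) auto
    finally have "real (card {n\<in>{..<N}. ?h i n}) \<le> real (card {k \<in> {1..?M}. \<exists>b\<in>B - K. b dvd k})"
      by simp
    also have "\<dots> \<le> real ?M * ?T"
      using pos summ' by (intro card_multiples_le)
    finally show ?thesis
      by (simp add: Int_def mult.assoc)
  qed
  have "\<bar>?f B n - ?f K n\<bar> \<le> (\<Sum>i\<in>F. of_bool (?h i n))" for n
  proof (cases "pattern_at B F a (\<lambda>_. n * q + r) = pattern_at K F a (\<lambda>_. n * q + r)")
    case False
    have "\<exists>i\<in>F. \<exists>b\<in>B - K. (n * q + r + i) mod b = 0"
      by (rule pattern_at_truncate[OF False assms(2)])
    then obtain i where i: "i \<in> F" "\<exists>b\<in>B - K. (n * q + r + i) mod b = 0"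
      by (rule bexE)
    then have h: "?h i n"
      by (simp only: dvd_eq_mod_eq_0)
    have "\<bar>?f B n - ?f K n\<bar> \<le> of_bool (?h i n)"
      using h by (simp only: of_bool_eq) simp
    also have "\<dots> \<le> (\<Sum>i\<in>F. of_bool (?h i n))"
      using member_le_sum[of i F "\<lambda>i. of_bool (?h i n) :: real"] i(1) F(1) by simp
    finally show ?thesis .
  qed (simp add: sum_nonneg)
  then have "\<bar>(\<Sum>n<N. ?f B n) - (\<Sum>n<N. ?f K n)\<bar> \<le> (\<Sum>n<N. \<Sum>i\<in>F. of_bool (?h i n))"
    unfolding sum_subtractf[symmetric] by (intro order_trans[OF sum_abs] sum_mono)
  also have "\<dots> = (\<Sum>i\<in>F. \<Sum>n<N. of_bool (?h i n))"
    by (rule sum.swap)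
  also have "\<dots> \<le> (\<Sum>i\<in>F. real N * (real (q + r + i) * ?T))"
    by (intro sum_mono count)
  also have "\<dots> = real N * (real (\<Sum>i\<in>F. q + r + i) * ?T)"
    by (simp add: sum_distrib_left sum_distrib_right)
  finally have "\<bar>(\<Sum>n<N. ?f B n) - (\<Sum>n<N. ?f K n)\<bar> \<le> real N * (real (\<Sum>i\<in>F. q + r + i) * ?T)" .
  then have "\<bar>(\<Sum>n<N. ?f B n) - (\<Sum>n<N. ?f K n)\<bar> / real N \<le> real (\<Sum>i\<in>F. q + r + i) * ?T"
    using \<open>N > 0\<close> by (simp only: pos_divide_le_eq of_nat_0_less_iff mult.commute)
  moreover have "1 / real N * x - 1 / real N * y = (x - y) / real N" for x y
    by (simp add: diff_divide_distrib)
  ultimately show ?thesis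
    by (simp only: abs_divide abs_of_nat)
qed

text \<open>For each \<open>r\<close> the inner average is that of a periodic sequence in
  \<open>n\<close> and tends to its mean over a period; the double sum over \<open>r\<close> and
  \<open>n\<close> is then evaluated by \<open>periodic_double_sum\<close>.\<close>

lemma average_pattern_at_finite_tendsto:
  assumes "finite K" "0 \<notin> K" and q: "gcd q (\<Prod>K) dvd P" and "P > 0"
  shows "(\<lambda>N. 1 / real P * (\<Sum>r<P. 1 / real N *
        (\<Sum>n<N. of_bool (pattern_at K F a (\<lambda>_. n * q + r)))))
      \<longlonglongrightarrow> 1 / real (\<Prod>K) * (\<Sum>k<\<Prod>K. of_bool (pattern_at K F a (\<lambda>_. k)))"
proof -
  define Q where "Q = \<Prod>K"
  define f where "f k = (of_bool (pattern_at K F a (\<lambda>_. k)) :: real)" for k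
  have per: "f (k + Q) = f k" for k
    using pattern_at_const_periodic[OF assms(1)] by (simp add: f_def Q_def)
  have "Q > 0"
    using assms by (auto simp: Q_def intro: gr0I)
  \<comment> \<open>The gcd hypothesis is exactly the solvability of this linear congruence.\<close>
  obtain t where t: "[t * q = P] (mod Q)"
    using cong_solve_dvd_nat[of q Q P] q by (auto simp: Q_def mult.commute)
  have "(\<lambda>N. 1 / real P * (\<Sum>r<P. 1 / real N * (\<Sum>n<N. f (n * q + r))))
      \<longlonglongrightarrow> 1 / real P * (\<Sum>r<P. 1 / real Q * (\<Sum>n<Q. f (n * q + r)))"
  proof (rule tendsto_mult[OF tendsto_const tendsto_sum], rule periodic_average_tendsto[OF _ \<open>Q > 0\<close>])
    show "f ((k + Q) * q + r) = f (k * q + r)" for k r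
      using periodic_mult[of f Q "k * q + r" q, OF per] by (simp add: algebra_simps)
  qed
  also have "1 / real P * (\<Sum>r<P. 1 / real Q * (\<Sum>n<Q. f (n * q + r))) = 1 / real Q * (\<Sum>k<Q. f k)"
    using periodic_double_sum[of f Q, OF per t \<open>Q > 0\<close>] \<open>P > 0\<close>
    by (simp add: sum_divide_distrib[symmetric])
  finally show ?thesis
    by (simp add: f_def Q_def)
qed

section \<open>Powers of \<open>p\<close> dividing products of elements of \<open>B\<close>\<close>

text \<open>The prime \<open>p\<close> divides at most one of the coprime factors, so the whole
  power must divide that factor. Positivity of \<open>j\<close> rules out the empty product.\<close>

lemma prime_power_dvd_prod_coprime:
  fixes K :: "nat set"
  assumes "finite K" "pairwise coprime K" "prime p" "p ^ j dvd \<Prod>K" "j > 0"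
  shows "\<exists>b\<in>K. p ^ j dvd b"
  using assms(1,2,4)
proof (induction K rule: finite_induct)
  case empty
  then show ?case
    using assms(3,5) by simp
next
  case (insert b K)
  have "coprime b (\<Prod>K)"
    using insert by (intro prod_coprime_right) (auto simp: pairwise_def)
  then have "\<not> (p dvd b \<and> p dvd \<Prod>K)"
    using assms(3) by (meson coprime_common_divisor not_prime_unit)
  then have "coprime (p ^ j) b \<or> coprime (p ^ j) (\<Prod>K)"
    using prime_imp_coprime[OF assms(3)] by (metis coprime_power_left_iff)
  moreover have "p ^ j dvd b * \<Prod>K"
    using insert by simp
  ultimately have "p ^ j dvd b \<or> p ^ j dvd \<Prod>K"
    by (metis coprime_dvd_mult_left_iff coprime_dvd_mult_right_iff)
  then show ?case
    using insert by (auto simp: pairwise_insert)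
qed

text \<open>This supplies the exponent of the theorem: the gcd is a power of \<open>p\<close>, and
  its exponent is bounded through the only element of \<open>B\<close> that \<open>p\<close> can
  divide, uniformly in \<open>K\<close> and \<open>s\<close>.\<close>

lemma ex_prime_power_bound:
  fixes B :: "nat set"
  assumes "\<And>b. b \<in> B \<Longrightarrow> b > 0" "pairwise coprime B" "prime p"
  shows "\<exists>m\<ge>1. \<forall>K s. finite K \<longrightarrow> K \<subseteq> B \<longrightarrow> gcd (p ^ s) (\<Prod>K) dvd p ^ m"
proof -
  have "\<exists>m\<ge>1. \<forall>b\<in>B. \<forall>j. p ^ j dvd b \<longrightarrow> j \<le> m"
  proof (cases "\<exists>c\<in>B. p dvd c")
    case True
    then obtain c where c: "c \<in> B" "p dvd c"
      by blast
    \<comment> \<open>Coprimality forces \<open>b = c\<close> when \<open>j > 0\<close>, and then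
      \<open>j < p ^ j \<le> c\<close>. So the crude choice \<open>m = c\<close> suffices.\<close>
    have "j \<le> c" if b: "b \<in> B" "p ^ j dvd b" for b j
    proof (cases "j = 0")
      case False
      then have "p dvd b"
        using b(2) by (meson dvd_power dvd_trans gr0I)
      then have "\<not> coprime b c"
        using c(2) assms(3) by (meson coprime_common_divisor not_prime_unit)
      then have "b = c"
        using b(1) c(1) assms(2) by (meson pairwiseD)
      then have "p ^ j \<le> c"
        using b assms(1) by (simp add: dvd_imp_le)
      moreover have "j < p ^ j"
        using prime_gt_1_nat[OF assms(3)] by (simp add: power_gt_expt)
      ultimately show ?thesis
        by simp
    qed simp
    moreover have "c \<ge> 1"
      using assms(1)[OF c(1)] by simp
    ultimately show ?thesis
      by blast
  next
    case False
    then have "j = 0" if "b \<in> B" "p ^ j dvd b" for b j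
      using that by (meson dvd_power dvd_trans gr0I)
    \<comment> \<open>All exponents are 0 here; the value 1 is taken to meet
      \<open>m \<ge> 1\<close>.\<close>
    then show ?thesis
      by (intro exI[of _ 1]) auto
  qed
  then obtain m where m: "m \<ge> 1" "\<And>b j. b \<in> B \<Longrightarrow> p ^ j dvd b \<Longrightarrow> j \<le> m"
    by blast
  have "gcd (p ^ s) (\<Prod>K) dvd p ^ m" if K: "finite K" "K \<subseteq> B" for K s
  proof -
    obtain j where j: "gcd (p ^ s) (\<Prod>K) = p ^ j"
      using divides_primepow_nat[OF assms(3), of "gcd (p ^ s) (\<Prod>K)" s] by auto
    have "j \<le> m"
    proof (cases "j = 0")
      case False
      moreover have "p ^ j dvd \<Prod>K"
        using j by (metis gcd_dvd2)
      ultimately have "\<exists>b\<in>K. p ^ j dvd b"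
        using K assms by (intro prime_power_dvd_prod_coprime) (auto intro: pairwise_subset)
      then show ?thesis
        using K m(2) by blast
    qed simp
    then show ?thesis
      using j by (simp add: le_imp_power_dvd)
  qed
  with m(1) show ?thesis
    by blast
qed

section \<open>Removing the truncation\<close>

text \<open>Three errors are made small: averages for \<open>B\<close> against those for
  \<open>K\<close>, averages for \<open>K\<close> against their limit, and the measure for
  \<open>K\<close> against that for \<open>B\<close>. The set \<open>K\<close> is chosen after
  \<open>q\<close>, \<open>P\<close> and \<open>F\<close>, and \<open>N\<close> after
  \<open>K\<close>.\<close>

lemma average_pattern_at_tendsto:
  assumes B: "\<And>b. b \<in> B \<Longrightarrow> b \<ge> 2" and "infinite B" "pairwise coprime B"
    and summ: "(\<lambda>b. 1 / real b) summable_on B"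
    and F: "finite F" "F \<subseteq> {1..}" and "q > 0" "P > 0"
    and gcd: "\<And>K. finite K \<Longrightarrow> K \<subseteq> B \<Longrightarrow> gcd q (\<Prod>K) dvd P"
  shows "(\<lambda>N. 1 / real P * (\<Sum>r<P. 1 / real N *
        (\<Sum>n<N. of_bool (pattern_at B F a (\<lambda>_. n * q + r)))))
      \<longlonglongrightarrow> measure (Omega B) {\<omega> \<in> space (Omega B). pattern_at B F a \<omega>}"
proof (rule LIMSEQ_I)
  fix \<epsilon> :: real
  assume "\<epsilon> > 0"
  \<comment> \<open>One constant dominates both \<open>card F\<close> and the truncation constants
    for all \<open>r < P\<close>; the summand 1 keeps it positive for empty
    \<open>F\<close>.\<close>
  define c where "c = 1 + real (\<Sum>i\<in>F. q + P + i)"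
  let ?g = "\<lambda>K r N. 1 / real N * (\<Sum>n<N. of_bool (pattern_at K F a (\<lambda>_. n * q + r))) :: real"
  let ?A = "\<lambda>K N. 1 / real P * (\<Sum>r<P. ?g K r N)"
  let ?m = "\<lambda>K. measure (Omega B) {\<omega> \<in> space (Omega B). pattern_at K F a \<omega>}"
  have "c > 0"
    by (simp add: c_def add_pos_nonneg del: of_nat_sum)
  then obtain K where K: "finite K" "K \<subseteq> B" "infsum (\<lambda>b. 1 / real b) (B - K) < \<epsilon> / (3 * c)"
    using small_tail[OF summ, of "\<epsilon> / (3 * c)"] \<open>\<epsilon> > 0\<close> by auto
  let ?T = "infsum (\<lambda>b. 1 / real b) (B - K)"
  have T: "?T \<ge> 0" "c * ?T < \<epsilon> / 3"
    using K(3) \<open>c > 0\<close> by (simp_all add: infsum_nonneg pos_less_divide_eq mult.commute)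
  have "real (card F) \<le> c"
  proof -
    have "card F \<le> (\<Sum>i\<in>F. q + P + i)"
      using \<open>q > 0\<close> by (subst card_eq_sum) (intro sum_mono, simp)
    then show ?thesis
      by (simp add: c_def del: of_nat_sum)
  qed
  then have "real (card F) * ?T < \<epsilon> / 3"
    using T by (meson mult_right_mono order_le_less_trans)
  moreover have "\<bar>?m B - ?m K\<bar> \<le> real (card F) * ?T"
    using assms K by (intro measure_pattern_at_truncate) auto
  ultimately have measure_close: "\<bar>?m B - ?m K\<bar> < \<epsilon> / 3"
    by linarith
  have average_close: "\<bar>?A B N - ?A K N\<bar> < \<epsilon> / 3" if "N > 0" for N
  proof -
    have "\<bar>?g B r N - ?g K r N\<bar> \<le> c * ?T" if "r < P" for r
    proof -
      have "\<bar>?g B r N - ?g K r N\<bar> \<le> real (\<Sum>i\<in>F. q + r + i) * ?T"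
        using assms K \<open>N > 0\<close> by (intro average_pattern_at_truncate) auto
      also have "\<dots> \<le> c * ?T"
      proof (rule mult_right_mono[OF _ T(1)])
        have "(\<Sum>i\<in>F. q + r + i) \<le> (\<Sum>i\<in>F. q + P + i)"
          using that by (intro sum_mono) simp
        then show "real (\<Sum>i\<in>F. q + r + i) \<le> c"
          by (simp add: c_def del: of_nat_sum)
      qed
      finally show ?thesis .
    qed
    then have "\<bar>(\<Sum>r<P. ?g B r N) - (\<Sum>r<P. ?g K r N)\<bar> \<le> (\<Sum>r<P. c * ?T)"
      unfolding sum_subtractf[symmetric] by (intro order_trans[OF sum_abs] sum_mono) simp
    then have "\<bar>(\<Sum>r<P. ?g B r N) - (\<Sum>r<P. ?g K r N)\<bar> / real P \<le> c * ?T"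
      using \<open>P > 0\<close> by (simp add: pos_divide_le_eq mult.commute)
    moreover have "1 / real P * x - 1 / real P * y = (x - y) / real P" for x y
      by (simp add: diff_divide_distrib)
    ultimately have "\<bar>?A B N - ?A K N\<bar> \<le> c * ?T"
      by (simp only: abs_divide abs_of_nat)
    then show ?thesis
      using T(2) by linarith
  qed
  have "0 \<notin> K" "pairwise coprime K"
    using B[of 0] K \<open>pairwise coprime B\<close> by (auto intro: pairwise_subset)
  then have "?A K \<longlonglongrightarrow> ?m K"
    using average_pattern_at_finite_tendsto[of K q P F a] measure_pattern_at_finite[of B F K a]
      assms K by simp
  then obtain N0 where N0: "\<And>N. N \<ge> N0 \<Longrightarrow> \<bar>?A K N - ?m K\<bar> < \<epsilon> / 3"
    using LIMSEQ_D[of "?A K" "?m K" "\<epsilon> / 3"] \<open>\<epsilon> > 0\<close> by (auto simp: real_norm_def)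
  \<comment> \<open>The successor ensures \<open>N > 0\<close>, as \<open>average_close\<close>
    demands.\<close>
  have "\<bar>?A B N - ?m B\<bar> < \<epsilon>" if "N \<ge> Suc N0" for N
    using average_close[of N] N0[of N] measure_close that by linarith
  then show "\<exists>N0. \<forall>N\<ge>N0. norm (?A B N - ?m B) < \<epsilon>"
    unfolding real_norm_def by blast
qed

theorem theorem4p4:
  fixes B :: "nat set" and p :: nat
  assumes "infinite B"
    and "\<forall>b\<in>B. b \<ge> 2"
    and "pairwise coprime B"
    and "(\<lambda>b. 1 / real b) summable_on B"
    and "prime p"
  shows "\<exists>m\<ge>1. \<forall>s\<ge>1. \<forall>C. is_cylinder C \<longrightarrow>
    (\<lambda>N. 1 / real (p ^ m) * (\<Sum>r<p ^ m. 1 / real N *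
        (\<Sum>n<N. indicator C ((seq_shift ^^ (n * p ^ s + r)) (eta B)))))
      \<longlonglongrightarrow> measure (nu B) C"
proof -
  have B: "b \<ge> 2" if "b \<in> B" for b
    using assms(2) that by blast
  have p: "p ^ k > 0" for k
    using prime_gt_0_nat[OF assms(5)] by simp
  have "b > 0" if "b \<in> B" for b
    using B[OF that] by simp
  \<comment> \<open>The exponent is fixed before \<open>s\<close> and \<open>C\<close>, as the order
    of quantifiers requires.\<close>
  then obtain m where m: "m \<ge> 1"
      "\<And>K s. finite K \<Longrightarrow> K \<subseteq> B \<Longrightarrow> gcd (p ^ s) (\<Prod>K) dvd p ^ m"
    using ex_prime_power_bound[OF _ assms(3,5)] by blast
  show ?thesis
  proof (intro exI[of _ m] conjI m(1) allI impI)
    fix s :: nat and C :: "(nat \<Rightarrow> nat) set"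
    assume C: "is_cylinder C"
    then obtain F a where F: "finite F" "F \<subseteq> {1..}"
      and C_eq: "C = {x \<in> seq_space. \<forall>i\<in>F. x i = a i}"
      by (auto simp: is_cylinder_def)
    have ind: "indicator C ((seq_shift ^^ k) (eta B)) = (of_bool (pattern_at B F a (\<lambda>_. k)) :: real)"
      for k
      using seq_shift_funpow_eta_mem[OF F(2), of k B a] by (simp add: C_eq indicator_def)
    have "phi B -` C \<inter> space (Omega B) = {\<omega> \<in> space (Omega B). pattern_at B F a \<omega>}"
      unfolding C_eq using phi_mem[OF F(2), of B _ a] by blast
    then have "measure (nu B) C = measure (Omega B) {\<omega> \<in> space (Omega B). pattern_at B F a \<omega>}"
      by (simp add: measure_nu_cylinder[OF C])
    then show "(\<lambda>N. 1 / real (p ^ m) * (\<Sum>r<p ^ m. 1 / real N *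
        (\<Sum>n<N. indicator C ((seq_shift ^^ (n * p ^ s + r)) (eta B)))))
        \<longlonglongrightarrow> measure (nu B) C"
      unfolding ind
      using average_pattern_at_tendsto[of B F "p ^ s" "p ^ m" a, OF B assms(1,3,4) F p p m(2)]
      by simp
  qed
qed

end
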